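(* For every symmetric $0,1$-matrix $M$ and every natural number $k$, if $M$ does not have a $k$-wide division, then $M$ admits a sequence of symmetric $2(k+1)$-diagonal divisions.
   Context: Let $M$ be a symmetric $n\times n$ $0,1$-matrix with rows $r_1,\dots,r_n$ and columns $c_1,\dots,c_n$. A symmetric partition of $M$ is a pair $(\mathcal R,\mathcal C)$ with $\mathcal R$ a partition of the rows and $\mathcal C$ a partition of the columns such that $r_i,r_j$ lie in the same part iff $c_i,c_j$ do. A symmetric partition sequence of $M$ is a sequence $(\mathcal R_n,\mathcal C_n),\dots,(\mathcal R_1,\mathcal C_1)$ of symmetric partitions, starting with the partition into singletons, ending with one row part and one column part, each obtained from the previous one by merging two row parts and the two symmetric column parts. A (symmetric) division is a symmetric partition whose parts consist of consecutive rows (columns), written $(R_1,\dots,R_p)$, $(C_1,\dots,C_p)$ in order, $C_i$ symmetric to $R_i$. A row part $R_i$ is $k$-wide if for every $k$ consecutive column parts $C_j,\dots,C_{j+k-1}$ with $j\le i\le j+k-1$, the submatrix with rows $R_i$ and all columns outside $C_j\cup\dots\cup C_{j+k-1}$ has at least $k$ distinct rows; symmetrically for column parts. A division is $k$-wide if all its row and column parts are $k$-wide, and $k$-diagonal if none of its row and column parts is $k$-wide. A sequence of symmetric $k$-diagonal divisions is a symmetric partition sequence each of whose partitions is a $k$-diagonal division. *)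

theory Defs
  imports
    "HOL-Library.Disjoint_Sets"
    "Jordan_Normal_Form.DL_Submatrix"
begin

text \<open>
  Rows and columns of an $n \times n$ matrix are identified with their indices in \<open>{..<n}\<close>
  (counted from 0), so the column part symmetric to a row part is given by the same index set.
\<close>

definition zero_one_mat :: "int mat \<Rightarrow> bool" where
  "zero_one_mat M \<longleftrightarrow> elements_mat M \<subseteq> {0, 1}"

definition symmetric_mat :: "'a mat \<Rightarrow> bool" where
  "symmetric_mat M \<longleftrightarrow> transpose_mat M = M"

type_synonym bipartition = "nat set set \<times> nat set set"

definition same_part :: "nat set set \<Rightarrow> nat \<Rightarrow> nat \<Rightarrow> bool" where
  "same_part P i j \<longleftrightarrow> (\<exists>A\<in>P. i \<in> A \<and> j \<in> A)"

definition symmetric_partition :: "nat \<Rightarrow> bipartition \<Rightarrow> bool" where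
  "symmetric_partition n D \<longleftrightarrow>
     partition_on {..<n} (fst D) \<and> partition_on {..<n} (snd D) \<and>
     (\<forall>i<n. \<forall>j<n. same_part (fst D) i j \<longleftrightarrow> same_part (snd D) i j)"

definition singletons :: "nat \<Rightarrow> nat set set" where
  "singletons n = (\<lambda>i. {i}) ` {..<n}"

definition merge_parts :: "nat set \<Rightarrow> nat set \<Rightarrow> nat set set \<Rightarrow> nat set set" where
  "merge_parts A B P = insert (A \<union> B) (P - {A, B})"

definition merge_step :: "bipartition \<Rightarrow> bipartition \<Rightarrow> bool" where
  "merge_step D D' \<longleftrightarrow>
     (\<exists>A B. A \<in> fst D \<and> B \<in> fst D \<and> A \<in> snd D \<and> B \<in> snd D \<and> A \<noteq> B \<and>
        fst D' = merge_parts A B (fst D) \<and> snd D' = merge_parts A B (snd D))"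

text \<open>
  The list enumerates $(\mathcal R_n, \mathcal C_n), \dots, (\mathcal R_1, \mathcal C_1)$;
  its length is \<open>n\<close> because each step decreases the number of parts by one.
\<close>

definition symmetric_partition_sequence :: "nat \<Rightarrow> bipartition list \<Rightarrow> bool" where
  "symmetric_partition_sequence n S \<longleftrightarrow>
     S \<noteq> [] \<and> (\<forall>D\<in>set S. symmetric_partition n D) \<and>
     hd S = (singletons n, singletons n) \<and>
     card (fst (last S)) = 1 \<and> card (snd (last S)) = 1 \<and>
     successively merge_step S"

definition consecutive :: "nat set \<Rightarrow> bool" where
  "consecutive A \<longleftrightarrow> (\<exists>a b. A = {a..<b})"

definition symmetric_division :: "nat \<Rightarrow> bipartition \<Rightarrow> bool" where
  "symmetric_division n D \<longleftrightarrow>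
     symmetric_partition n D \<and> (\<forall>A \<in> fst D \<union> snd D. consecutive A)"

definition ordered_parts :: "nat set set \<Rightarrow> nat set list" where
  "ordered_parts P = sorted_key_list_of_set Min P"

text \<open>
  The union of the \<open>k\<close> consecutive parts at positions \<open>j, \<dots>, j + k - 1\<close> of the list \<open>ps\<close>.
  The start \<open>j\<close> is an integer and positions outside the list contribute nothing, i.e. a window
  may stick out of the division. When the division has at least \<open>k\<close> parts, the windows that
  stick out do not affect \<open>k\<close>-wideness, since each is contained in one that does not, and
  enlarging the window can only identify rows. When it has fewer than \<open>k\<close> parts, they supply the
  window consisting of all parts; otherwise such a division would be vacuously \<open>k\<close>-wide.
\<close>

definition window :: "nat set list \<Rightarrow> int \<Rightarrow> nat \<Rightarrow> nat set" where
  "window ps j k = \<Union>{ps ! l | l. l < length ps \<and> j \<le> int l \<and> int l \<le> j + int k - 1}"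

definition num_distinct_rows :: "'a mat \<Rightarrow> nat" where
  "num_distinct_rows A = card (set (rows A))"

definition num_distinct_cols :: "'a mat \<Rightarrow> nat" where
  "num_distinct_cols A = card (set (cols A))"

definition wide_row_part :: "'a mat \<Rightarrow> nat \<Rightarrow> bipartition \<Rightarrow> nat \<Rightarrow> bool" where
  "wide_row_part M k D i \<longleftrightarrow>
     (\<forall>j::int. j \<le> int i \<and> int i \<le> j + int k - 1 \<longrightarrow>
        k \<le> num_distinct_rows (submatrix M (ordered_parts (fst D) ! i)
               ({..<dim_col M} - window (ordered_parts (snd D)) j k)))"

definition wide_col_part :: "'a mat \<Rightarrow> nat \<Rightarrow> bipartition \<Rightarrow> nat \<Rightarrow> bool" where
  "wide_col_part M k D i \<longleftrightarrow>
     (\<forall>j::int. j \<le> int i \<and> int i \<le> j + int k - 1 \<longrightarrow>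
        k \<le> num_distinct_cols (submatrix M
               ({..<dim_row M} - window (ordered_parts (fst D)) j k)
               (ordered_parts (snd D) ! i)))"

definition wide_division :: "'a mat \<Rightarrow> nat \<Rightarrow> bipartition \<Rightarrow> bool" where
  "wide_division M k D \<longleftrightarrow>
     (\<forall>i < card (fst D). wide_row_part M k D i) \<and>
     (\<forall>i < card (snd D). wide_col_part M k D i)"

definition diagonal_division :: "'a mat \<Rightarrow> nat \<Rightarrow> bipartition \<Rightarrow> bool" where
  "diagonal_division M k D \<longleftrightarrow>
     (\<forall>i < card (fst D). \<not> wide_row_part M k D i) \<and>
     (\<forall>i < card (snd D). \<not> wide_col_part M k D i)"

definition symmetric_diagonal_division_sequence ::
  "nat \<Rightarrow> 'a mat \<Rightarrow> nat \<Rightarrow> bipartition list \<Rightarrow> bool" where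
  "symmetric_diagonal_division_sequence n M k S \<longleftrightarrow>
     symmetric_partition_sequence n S \<and>
     (\<forall>D\<in>set S. symmetric_division n D \<and> diagonal_division M k D)"

end

theory Submission
  imports Defs
begin

text \<open>
  The division into singletons is diagonal, since a single row is a single distinct row. Merging
  two neighbouring parts of a division never turns another part wide, because windows only become
  larger. To find two parts that can be merged, merge all parts in pairs (the last three together
  if their number is odd). The resulting coarse division is not \<open>k\<close>-wide, so one of its row
  parts has fewer than \<open>k\<close> distinct rows outside some \<open>k\<close> consecutive coarse parts, which
  consist of at most \<open>2k + 1\<close> original parts. Merging only two of the constituents of that row
  part keeps the division \<open>2(k + 1)\<close>-diagonal.
\<close>

section \<open>Distinct rows of submatrices\<close>

text \<open>Both images are in bijection with the classes of the common kernel on \<open>A\<close>: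
  sending \<open>f x\<close> to \<open>g x\<close> is well defined and injective. This lets rows
  stored as vectors be counted as functions.\<close>

lemma card_image_cong_kernel:
  assumes "\<And>x y. x \<in> A \<Longrightarrow> y \<in> A \<Longrightarrow> f x = f y \<longleftrightarrow> g x = g y"
  shows "card (f ` A) = card (g ` A)"
proof -
  define h where "h = g \<circ> inv_into A f"
  have h: "h (f x) = g x" if "x \<in> A" for x
    using that assms[of "inv_into A f (f x)" x]
    by (simp add: h_def f_inv_into_f inv_into_into)
  have "inj_on h (f ` A)"
    by (rule inj_onI) (metis (no_types, lifting) assms h imageE)
  then have "card (h ` f ` A) = card (f ` A)"
    by (rule card_image)
  moreover have "h ` f ` A = g ` A"
    using h by (simp add: image_image)
  ultimately show ?thesis by simp
qed

text \<open>An element \<open>i\<close> of \<open>I\<close> is hit at the position given by the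
  number of smaller elements of \<open>I\<close>.\<close>

lemma pick_image_lessThan_card:
  assumes "finite I"
  shows "pick I ` {..<card I} = I"
proof
  show "pick I ` {..<card I} \<subseteq> I"
    by (blast intro: pick_in_set_le)
  show "I \<subseteq> pick I ` {..<card I}"
  proof
    fix i assume "i \<in> I"
    then have "{a \<in> I. a < i} \<subset> I" by blast
    then have "card {a \<in> I. a < i} < card I"
      by (rule psubset_card_mono[OF assms])
    then have "pick I (card {a \<in> I. a < i}) \<in> pick I ` {..<card I}"
      by blast
    then show "i \<in> pick I ` {..<card I}"
      by (simp only: pick_card_in_set[OF \<open>i \<in> I\<close>])
  qed
qed

text \<open>Counting restricted functions keeps the original indices and so avoids the renumbering
  done by \<open>submatrix\<close>. Outside \<open>J\<close> every \<open>restrict\<close> is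
  \<open>undefined\<close>, so equality means agreement on \<open>J\<close>.\<close>

definition distinct_rows :: "'a mat \<Rightarrow> nat set \<Rightarrow> nat set \<Rightarrow> nat" where
  "distinct_rows M I J = card ((\<lambda>i. restrict (\<lambda>j. M $$ (i, j)) J) ` I)"

lemma num_distinct_rows_submatrix:
  assumes I: "I \<subseteq> {..<dim_row M}" and J: "J \<subseteq> {..<dim_col M}"
  shows "num_distinct_rows (submatrix M I J) = distinct_rows M I J"
proof -
  let ?S = "submatrix M I J"
  have fin: "finite I" "finite J"
    using I J finite_subset by auto
  have "{i. i < dim_row M \<and> i \<in> I} = I" "{j. j < dim_col M \<and> j \<in> J} = J"
    using I J by auto
  then have dim: "dim_row ?S = card I" "dim_col ?S = card J"
    and idx: "\<And>i j. i < card I \<Longrightarrow> j < card J \<Longrightarrow> ?S $$ (i, j) = M $$ (pick I i, pick J j)"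
    by (simp_all add: submatrix_def)
  have "row ?S i = row ?S i' \<longleftrightarrow>
      restrict (\<lambda>j. M $$ (pick I i, j)) J = restrict (\<lambda>j. M $$ (pick I i', j)) J"
    if "i < card I" "i' < card I" for i i'
  proof -
    have "row ?S i = row ?S i' \<longleftrightarrow>
        (\<forall>j < card J. M $$ (pick I i, pick J j) = M $$ (pick I i', pick J j))"
      using that dim idx by (auto simp: vec_eq_iff)
    also have "\<dots> \<longleftrightarrow> (\<forall>j \<in> pick J ` {..<card J}. M $$ (pick I i, j) = M $$ (pick I i', j))"
      by auto
    also have "\<dots> \<longleftrightarrow> (\<forall>j\<in>J. M $$ (pick I i, j) = M $$ (pick I i', j))"
      by (simp only: pick_image_lessThan_card[OF fin(2)])
    also have "\<dots> \<longleftrightarrow> restrict (\<lambda>j. M $$ (pick I i, j)) J = restrict (\<lambda>j. M $$ (pick I i', j)) J"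
      by (auto simp: restrict_def fun_eq_iff)
    finally show ?thesis .
  qed
  then have "card (row ?S ` {..<card I}) =
      card ((\<lambda>i. restrict (\<lambda>j. M $$ (pick I i, j)) J) ` {..<card I})"
    by (intro card_image_cong_kernel) auto
  also have "\<dots> = card ((\<lambda>i. restrict (\<lambda>j. M $$ (i, j)) J) ` pick I ` {..<card I})"
    by (simp add: image_image)
  finally show ?thesis
    by (simp add: num_distinct_rows_def distinct_rows_def rows_def dim atLeast0LessThan
        pick_image_lessThan_card[OF fin(1)])
qed

lemma transpose_submatrix: "(submatrix M I J)\<^sup>T = submatrix M\<^sup>T J I"
proof (rule eq_matI)
  fix i j assume "i < dim_row (submatrix M\<^sup>T J I)" "j < dim_col (submatrix M\<^sup>T J I)"
  then have i: "i < card {a. a < dim_col M \<and> a \<in> J}" and j: "j < card {a. a < dim_row M \<and> a \<in> I}"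
    by (simp_all add: dim_submatrix)
  then show "(submatrix M I J)\<^sup>T $$ (i, j) = submatrix M\<^sup>T J I $$ (i, j)"
    using pick_le[OF i] pick_le[OF j] by (simp add: submatrix_index dim_submatrix)
qed (simp_all add: dim_submatrix)

lemma num_distinct_cols_submatrix:
  assumes "symmetric_mat M"
  shows "num_distinct_cols (submatrix M I J) = num_distinct_rows (submatrix M J I)"
proof -
  have "cols (submatrix M I J) = rows (submatrix M I J)\<^sup>T" by simp
  also have "(submatrix M I J)\<^sup>T = submatrix M J I"
    using assms by (simp only: transpose_submatrix symmetric_mat_def)
  finally show ?thesis
    by (simp add: num_distinct_cols_def num_distinct_rows_def)
qed

text \<open>Rows restricted to \<open>J\<close> are images of rows restricted to \<open>J'\<close>,
  so deleting columns can only identify rows; deleting rows only shrinks the counted set.\<close>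

lemma distinct_rows_mono:
  assumes "I \<subseteq> I'" "finite I'" "J \<subseteq> J'"
  shows "distinct_rows M I J \<le> distinct_rows M I' J'"
proof -
  let ?r = "\<lambda>J i. restrict (\<lambda>j. M $$ (i, j)) J"
  have "?r J ` I = (\<lambda>r. restrict r J) ` ?r J' ` I"
    using assms(3) by (simp add: image_image Int_absorb1)
  then have "distinct_rows M I J \<le> card (?r J' ` I)"
    unfolding distinct_rows_def using finite_subset[OF assms(1,2)]
    by (simp add: card_image_le)
  also have "\<dots> \<le> card (?r J' ` I')"
    using assms by (intro card_mono) auto
  finally show ?thesis by (simp add: distinct_rows_def)
qed

section \<open>Divisions given by cut positions\<close>

text \<open>Boundary positions encode a division into \<open>p\<close> intervals, nonempty by
  strictness. A run of consecutive parts is then one interval, and merging two neighbours deletes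
  one boundary.\<close>

definition cuts :: "nat \<Rightarrow> nat \<Rightarrow> (nat \<Rightarrow> nat) \<Rightarrow> bool" where
  "cuts n p c \<longleftrightarrow> strict_mono_on {..p} c \<and> c 0 = 0 \<and> c p = n"

definition blocks :: "nat \<Rightarrow> (nat \<Rightarrow> nat) \<Rightarrow> nat set list" where
  "blocks p c = map (\<lambda>l. {c l..<c (Suc l)}) [0..<p]"

definition cut_division :: "nat \<Rightarrow> (nat \<Rightarrow> nat) \<Rightarrow> bipartition" where
  "cut_division p c = (set (blocks p c), set (blocks p c))"

lemma cuts_less: "cuts n p c \<Longrightarrow> i < j \<Longrightarrow> j \<le> p \<Longrightarrow> c i < c j"
  by (auto simp: cuts_def strict_mono_on_def)

lemma cuts_le: "cuts n p c \<Longrightarrow> i \<le> j \<Longrightarrow> j \<le> p \<Longrightarrow> c i \<le> c j"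
  using cuts_less by (metis le_eq_less_or_eq)

lemma cuts_le_end: "cuts n p c \<Longrightarrow> i \<le> p \<Longrightarrow> c i \<le> n"
  using cuts_le[of n p c i p] by (simp add: cuts_def)

lemma length_blocks [simp]: "length (blocks p c) = p"
  by (simp add: blocks_def)

lemma nth_blocks [simp]: "i < p \<Longrightarrow> blocks p c ! i = {c i..<c (Suc i)}"
  by (simp add: blocks_def)

lemma set_blocks: "set (blocks p c) = (\<lambda>l. {c l..<c (Suc l)}) ` {..<p}"
  by (simp add: blocks_def atLeast0LessThan)

lemma Min_block:
  assumes "cuts n p c" "l < p"
  shows "Min {c l..<c (Suc l)} = c l"
  using cuts_less[OF assms(1), of l "Suc l"] assms(2) by (intro Min_eqI) auto

lemma inj_on_block:
  assumes "cuts n p c"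
  shows "inj_on (\<lambda>l. {c l..<c (Suc l)}) {..<p}"
proof (rule inj_onI)
  fix i j assume ij: "i \<in> {..<p}" "j \<in> {..<p}" "{c i..<c (Suc i)} = {c j..<c (Suc j)}"
  then have "c i = c j"
    using Min_block[OF assms] by (metis lessThan_iff)
  then show "i = j"
    using cuts_less[OF assms, of i j] cuts_less[OF assms, of j i] ij by fastforce
qed

lemma card_set_blocks: "cuts n p c \<Longrightarrow> card (set (blocks p c)) = p"
  using card_image[OF inj_on_block] by (simp add: set_blocks)

lemma (in linorder) sorted_key_list_of_set_eqI:
  assumes "sorted_wrt (<) (map f xs)"
  shows "sorted_key_list_of_set f (set xs) = xs"
proof -
  have "sorted (map f xs)" "distinct (map f xs)"
    using assms by (simp_all add: strict_sorted_iff)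
  then have "inj_on f (set xs)" "distinct xs"
    by (simp_all add: distinct_map)
  then interpret folding_insort_key "(\<le>)" "(<)" "set xs" f
    by unfold_locales
  show ?thesis
    using \<open>sorted (map f xs)\<close> \<open>distinct xs\<close> by (intro idem_if_sorted_distinct) auto
qed

lemma ordered_parts_blocks:
  assumes "cuts n p c"
  shows "ordered_parts (set (blocks p c)) = blocks p c"
  unfolding ordered_parts_def
  by (rule sorted_key_list_of_set_eqI)
    (auto simp: sorted_wrt_iff_nth_less Min_block[OF assms] intro!: cuts_less[OF assms])

lemma UN_blocks:
  assumes "cuts n p c" "a \<le> b" "b \<le> p"
  shows "(\<Union>l\<in>{a..<b}. {c l..<c (Suc l)}) = {c a..<c b}"
  using assms(2,3)
proof (induction b rule: dec_induct)
  case (step b)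
  have "c a \<le> c b" "c b \<le> c (Suc b)"
    using step cuts_le[OF assms(1)] by auto
  then show ?case
    using step by (auto simp: atLeastLessThanSuc)
qed simp

text \<open>A window sticking out of the division is clipped: \<open>nat\<close> raises a negative
  start to 0, and \<open>min p\<close> lowers an end beyond the last cut.\<close>

lemma window_blocks:
  assumes "cuts n p c" "j < int p"
  shows "window (blocks p c) j k = {c (nat j)..<c (min p (nat (j + int k)))}"
proof -
  have "{blocks p c ! l | l. l < length (blocks p c) \<and> j \<le> int l \<and> int l \<le> j + int k - 1}
      = (\<lambda>l. {c l..<c (Suc l)}) ` {nat j..<min p (nat (j + int k))}"
    by (force simp: image_iff)
  then have "window (blocks p c) j k
      = (\<Union>l\<in>{nat j..<min p (nat (j + int k))}. {c l..<c (Suc l)})"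
    by (simp add: window_def)
  also have "\<dots> = {c (nat j)..<c (min p (nat (j + int k)))}"
    using assms(2) by (intro UN_blocks[OF assms(1)]) auto
  finally show ?thesis .
qed

lemma symmetric_division_cut_division:
  assumes "cuts n p c"
  shows "symmetric_division n (cut_division p c)"
proof -
  have "partition_on {..<n} (set (blocks p c))"
  proof (rule partition_onI)
    have "\<Union>(set (blocks p c)) = {c 0..<c p}"
      unfolding set_blocks using UN_blocks[OF assms, of 0 p] by (simp add: atLeast0LessThan)
    then show "\<Union>(set (blocks p c)) = {..<n}"
      using assms by (auto simp: cuts_def)
    show "{} \<notin> set (blocks p c)"
      using cuts_less[OF assms] by (fastforce simp: set_blocks)
    have "disjnt {c i..<c (Suc i)} {c j..<c (Suc j)}" if "i < j" "j < p" for i j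
      using cuts_le[OF assms, of "Suc i" j] that by (auto simp: disjnt_def)
    then show "disjnt A B" if "A \<in> set (blocks p c)" "B \<in> set (blocks p c)" "A \<noteq> B" for A B
      using that unfolding set_blocks
      by (smt (verit) disjnt_sym image_iff lessThan_iff linorder_neqE_nat)
  qed
  then show ?thesis
    by (auto simp: symmetric_division_def symmetric_partition_def cut_division_def set_blocks
        consecutive_def)
qed

section \<open>Narrow parts\<close>

text \<open>The failure of \<open>wide_row_part\<close> in terms of cuts, with the window written as
  a clipped interval.\<close>

definition narrow :: "'a mat \<Rightarrow> nat \<Rightarrow> nat \<Rightarrow> nat \<Rightarrow> (nat \<Rightarrow> nat) \<Rightarrow> nat \<Rightarrow> bool" where
  "narrow M n k p c i \<longleftrightarrow> (\<exists>j. j \<le> int i \<and> int i < j + int k \<and>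
     distinct_rows M {c i..<c (Suc i)}
       ({..<n} - {c (nat j)..<c (min p (nat (j + int k)))}) < k)"

lemma wide_row_part_cut_division:
  assumes "M \<in> carrier_mat n n" "cuts n p c" "i < p"
  shows "wide_row_part M k (cut_division p c) i \<longleftrightarrow> \<not> narrow M n k p c i"
proof -
  have "{c i..<c (Suc i)} \<subseteq> {..<n}"
    using cuts_le_end[OF assms(2), of "Suc i"] assms(3) by auto
  then have "num_distinct_rows (submatrix M {c i..<c (Suc i)} ({..<n} - W))
      = distinct_rows M {c i..<c (Suc i)} ({..<n} - W)" for W
    using assms(1) by (intro num_distinct_rows_submatrix) auto
  then show ?thesis
    using assms(1,3)
    by (auto simp: wide_row_part_def narrow_def cut_division_def ordered_parts_blocks[OF assms(2)]
        window_blocks[OF assms(2)] not_less)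
qed

text \<open>Rows and columns carry the same index sets, and transposing a submatrix of a symmetric
  matrix swaps its two index sets. Hence only row parts need be treated below.\<close>

lemma wide_col_part_cut_division:
  assumes "M \<in> carrier_mat n n" "symmetric_mat M"
  shows "wide_col_part M k (cut_division p c) i \<longleftrightarrow> wide_row_part M k (cut_division p c) i"
  using assms
  by (auto simp: wide_col_part_def wide_row_part_def cut_division_def num_distinct_cols_submatrix)

lemma wide_division_cut_division:
  assumes "M \<in> carrier_mat n n" "symmetric_mat M" "cuts n p c"
  shows "wide_division M k (cut_division p c) \<longleftrightarrow> (\<forall>i < p. \<not> narrow M n k p c i)"
  using wide_row_part_cut_division[OF assms(1,3)] card_set_blocks[OF assms(3)]
  unfolding wide_division_def wide_col_part_cut_division[OF assms(1,2)]
  by (auto simp: cut_division_def)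

lemma diagonal_division_cut_division:
  assumes "M \<in> carrier_mat n n" "symmetric_mat M" "cuts n p c"
  shows "diagonal_division M k (cut_division p c) \<longleftrightarrow> (\<forall>i < p. narrow M n k p c i)"
  using wide_row_part_cut_division[OF assms(1,3)] card_set_blocks[OF assms(3)]
  unfolding diagonal_division_def wide_col_part_cut_division[OF assms(1,2)]
  by (auto simp: cut_division_def)

text \<open>A bound on distinct rows survives when the part shrinks and the window grows. Both
  preservation results for merging are instances of this.\<close>

lemma narrow_transfer:
  assumes "j \<le> int i" "int i < j + int k"
    and "distinct_rows M {a..<b} ({..<n} - {s..<t}) < k"
    and "a \<le> c i" "c (Suc i) \<le> b" "c (nat j) \<le> s" "t \<le> c (min p (nat (j + int k)))"
  shows "narrow M n k p c i"
proof -
  have "distinct_rows M {c i..<c (Suc i)} ({..<n} - {c (nat j)..<c (min p (nat (j + int k)))})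
      \<le> distinct_rows M {a..<b} ({..<n} - {s..<t})"
    using assms(4-) by (intro distinct_rows_mono) auto
  then show ?thesis
    using assms(1-3) unfolding narrow_def by (meson le_less_trans)
qed

section \<open>Merging parts\<close>

text \<open>Removes the boundary \<open>c (Suc a)\<close>, so that parts \<open>a\<close> and
  \<open>Suc a\<close> become the new part \<open>a\<close>.\<close>

definition drop_cut :: "nat \<Rightarrow> (nat \<Rightarrow> nat) \<Rightarrow> nat \<Rightarrow> nat" where
  "drop_cut a c l = (if l \<le> a then c l else c (Suc l))"

lemma cuts_drop_cut:
  assumes "cuts n (Suc p) c" "a < p"
  shows "cuts n p (drop_cut a c)"
  using assms by (auto simp: cuts_def drop_cut_def strict_mono_on_def)

lemma merge_step_drop_cut:
  assumes c: "cuts n (Suc p) c" and a: "a < p"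
  shows "merge_step (cut_division (Suc p) c) (cut_division p (drop_cut a c))"
proof -
  let ?b = "\<lambda>l. {c l..<c (Suc l)}" and ?A = "{c a..<c (Suc a)}" and ?B = "{c (Suc a)..<c (Suc (Suc a))}"
  let ?d = "\<lambda>l. {drop_cut a c l..<drop_cut a c (Suc l)}"
  have union: "?A \<union> ?B = ?d a"
    using cuts_le[OF c, of a "Suc a"] cuts_le[OF c, of "Suc a" "Suc (Suc a)"] a
    by (auto simp: drop_cut_def)
  have inj: "inj_on ?b {..<Suc p}" by (rule inj_on_block[OF c])
  have neq: "?A \<noteq> ?B"
    using inj_onD[OF inj, of a "Suc a"] a by auto
  \<comment> \<open>Parts left of the merged pair keep their index, those right of it move down by
    one.\<close>
  have split: "{..<Suc p} - {a, Suc a} = {..<a} \<union> Suc ` {Suc a..<p}"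
    using a by (auto simp: image_Suc_atLeastLessThan)
  have "?b ` {..<Suc p} - {?A, ?B} = ?b ` ({..<Suc p} - {a, Suc a})"
    using inj_on_image_set_diff[OF inj, of "{..<Suc p}" "{a, Suc a}"] a by auto
  also have "\<dots> = ?b ` {..<a} \<union> (\<lambda>l. ?b (Suc l)) ` {Suc a..<p}"
    by (simp only: split image_Un image_image)
  also have "\<dots> = ?d ` {..<a} \<union> ?d ` {Suc a..<p}"
    by (intro arg_cong2[where f = "(\<union>)"] image_cong) (auto simp: drop_cut_def)
  finally have rest: "?b ` {..<Suc p} - {?A, ?B} = ?d ` {..<a} \<union> ?d ` {Suc a..<p}" .
  have "{..<p} = insert a ({..<a} \<union> {Suc a..<p})"
    using a by auto
  then have "?d ` {..<p} = insert (?A \<union> ?B) (?b ` {..<Suc p} - {?A, ?B})"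
    unfolding rest union by auto
  moreover have "?A \<in> ?b ` {..<Suc p}" "?B \<in> ?b ` {..<Suc p}"
    using a by auto
  ultimately show ?thesis
    unfolding merge_step_def cut_division_def set_blocks merge_parts_def fst_conv snd_conv
    using neq by blast
qed

text \<open>An unmerged part keeps its rows, and a window of \<open>K\<close> new parts, suitably
  placed, covers its old window. Only the merged part therefore needs a separate hypothesis.\<close>

lemma narrow_drop_cut:
  assumes c: "cuts n (Suc p) c" and a: "a < p" and K: "2 \<le> K"
    and old: "\<forall>i < Suc p. narrow M n K (Suc p) c i"
    and merged: "narrow M n K p (drop_cut a c) a"
    and i: "i < p"
  shows "narrow M n K p (drop_cut a c) i"
proof (cases "i = a")
  case True
  then show ?thesis using merged by simp
next
  case False
  \<comment> \<open>The index in the old division of the new part \<open>i\<close>.\<close>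
  define i' where "i' = (if i < a then i else Suc i)"
  have "narrow M n K (Suc p) c i'"
    using old i by (simp add: i'_def)
  then obtain j where j: "j \<le> int i'" "int i' < j + int K"
    and rows: "distinct_rows M {c i'..<c (Suc i')}
      ({..<n} - {c (nat j)..<c (min (Suc p) (nat (j + int K)))}) < K"
    unfolding narrow_def by blast
  \<comment> \<open>The start follows the renumbering. An old window starting at
    \<open>Suc a\<close>, the second half of the merged part, now starts at \<open>a\<close> and
    takes in the whole merged part.\<close>
  define j' where "j' = (if j \<le> int a then j else j - 1)"
  show ?thesis
  proof (rule narrow_transfer[OF _ _ rows])
    show "j' \<le> int i" "int i < j' + int K"
      using j False K by (auto simp: i'_def j'_def split: if_splits)
    show "c i' \<le> drop_cut a c i" "drop_cut a c (Suc i) \<le> c (Suc i')"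
      using False by (auto simp: i'_def drop_cut_def)
    show "drop_cut a c (nat j') \<le> c (nat j)"
    proof -
      have "nat j \<le> Suc p" using j i by (auto simp: i'_def split: if_splits)
      moreover have "Suc (nat (j - 1)) = nat j" if "j > int a" using that by auto
      ultimately show ?thesis
        by (auto simp: j'_def drop_cut_def intro!: cuts_le[OF c])
    qed
    show "c (min (Suc p) (nat (j + int K))) \<le> drop_cut a c (min p (nat (j' + int K)))"
      using K a by (auto simp: j'_def drop_cut_def intro!: cuts_le[OF c])
  qed
qed

section \<open>Coarsening a division by pairs\<close>

text \<open>The final cut is \<open>c p\<close> instead of \<open>c (2 * (p div 2))\<close>, so for
  odd \<open>p\<close> the last coarse part absorbs the leftover part.\<close>

definition pair_cuts :: "nat \<Rightarrow> (nat \<Rightarrow> nat) \<Rightarrow> nat \<Rightarrow> nat" where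
  "pair_cuts p c l = (if l < p div 2 then c (2 * l) else c p)"

lemma cuts_pair_cuts:
  assumes "cuts n p c" "2 \<le> p"
  shows "cuts n (p div 2) (pair_cuts p c)"
proof -
  have "pair_cuts p c i < pair_cuts p c j" if "i < j" "j \<le> p div 2" for i j
    using that by (auto simp: pair_cuts_def intro!: cuts_less[OF assms(1)])
  moreover have "0 < p div 2" using assms(2) by (simp add: div_greater_zero_iff)
  ultimately show ?thesis
    using assms(1) by (auto simp: cuts_def strict_mono_on_def pair_cuts_def)
qed

text \<open>Coarse part \<open>i\<close> contains the fine parts \<open>2 * i\<close> and
  \<open>Suc (2 * i)\<close>, whose union is part \<open>2 * i\<close> after the merge. The coarse
  window starting at \<open>j\<close> lies within the window of \<open>2 * (k + 1)\<close> parts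
  starting at \<open>2 * j\<close>.\<close>

lemma narrow_pair_cuts:
  assumes c: "cuts n (Suc p) c" and i: "i < Suc p div 2"
    and narrow: "narrow M n k (Suc p div 2) (pair_cuts (Suc p) c) i"
  shows "narrow M n (2 * (k + 1)) p (drop_cut (2 * i) c) (2 * i)"
proof -
  let ?d = "pair_cuts (Suc p) c" and ?e = "drop_cut (2 * i) c" and ?m = "Suc p div 2"
  obtain j where j: "j \<le> int i" "int i < j + int k"
    and rows: "distinct_rows M {?d i..<?d (Suc i)}
      ({..<n} - {?d (nat j)..<?d (min ?m (nat (j + int k)))}) < k"
    using narrow unfolding narrow_def by blast
  have p: "2 * i < p" using i by linarith
  have e_ge: "c l \<le> ?e l'" if "l \<le> l'" "l' \<le> p" for l l'
    using that by (auto simp: drop_cut_def intro!: cuts_le[OF c])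
  have "distinct_rows M {?d i..<?d (Suc i)}
      ({..<n} - {?d (nat j)..<?d (min ?m (nat (j + int k)))}) < 2 * (k + 1)"
    using rows by simp
  then show ?thesis
  proof (rule narrow_transfer[rotated 2, where j = "2 * j"])
    show "2 * j \<le> int (2 * i)" "int (2 * i) < 2 * j + int (2 * (k + 1))"
      using j by auto
    show "?d i \<le> ?e (2 * i)"
      using i by (simp add: pair_cuts_def drop_cut_def)
    show "?e (Suc (2 * i)) \<le> ?d (Suc i)"
      using p by (auto simp: pair_cuts_def drop_cut_def intro!: cuts_le[OF c])
    show "?e (nat (2 * j)) \<le> ?d (nat j)"
    proof -
      have "nat j \<le> i" "nat (2 * j) = 2 * nat j" using j by auto
      then show ?thesis using i by (simp add: pair_cuts_def drop_cut_def)
    qed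
    show "?d (min ?m (nat (j + int k))) \<le> ?e (min p (nat (2 * j + int (2 * (k + 1)))))"
    proof (cases "nat (j + int k) < ?m")
      case True
      then show ?thesis
        by (auto simp: pair_cuts_def intro!: e_ge)
    \<comment> \<open>Here the coarse window reaches the end of the matrix. Since
      \<open>2 * ?m\<close> is at least \<open>p\<close>, the fine window reaches it too.\<close>
    next
      case False
      then have "min p (nat (2 * j + int (2 * (k + 1)))) = p"
        by auto
      then show ?thesis
        using False p by (simp add: pair_cuts_def drop_cut_def)
    qed
  qed
qed

section \<open>Construction of the sequence\<close>

text \<open>Induction on the number of parts. The start is an arbitrary division with all parts
  narrow, so that the induction hypothesis applies after one merge; the clause on
  \<open>hd S\<close> allows the current division to be prepended.\<close>

lemma diagonal_sequence_from_cuts: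
  assumes M: "M \<in> carrier_mat n n" "symmetric_mat M"
    and no_wide: "\<not> (\<exists>D. symmetric_division n D \<and> wide_division M k D)"
    and "cuts n (Suc p) c" "\<forall>i < Suc p. narrow M n (2 * (k + 1)) (Suc p) c i"
  shows "\<exists>S. S \<noteq> [] \<and> hd S = cut_division (Suc p) c \<and>
    card (fst (last S)) = 1 \<and> card (snd (last S)) = 1 \<and> successively merge_step S \<and>
    (\<forall>D\<in>set S. symmetric_division n D \<and> diagonal_division M (2 * (k + 1)) D)"
  using assms(4,5)
proof (induction p arbitrary: c)
  case 0
  have "card (set (blocks (Suc 0) c)) = 1"
    using card_set_blocks[OF 0(1)] by simp
  then show ?case
    using 0 diagonal_division_cut_division[OF M 0(1)] symmetric_division_cut_division[OF 0(1)]
    by (intro exI[of _ "[cut_division (Suc 0) c]"]) (simp add: cut_division_def)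
next
  case (Suc p)
  let ?p = "Suc (Suc p)"
  have "cuts n (?p div 2) (pair_cuts ?p c)"
    using Suc.prems(1) by (intro cuts_pair_cuts) auto
  \<comment> \<open>The absence of wide divisions is applied to the coarse division; its narrow part
    shows which two fine parts to merge.\<close>
  with no_wide obtain i where i: "i < ?p div 2" "narrow M n k (?p div 2) (pair_cuts ?p c) i"
    using wide_division_cut_division[OF M] symmetric_division_cut_division by blast
  let ?e = "drop_cut (2 * i) c"
  have a: "2 * i < Suc p" using i(1) by linarith
  have e: "cuts n (Suc p) ?e"
    using Suc.prems(1) a by (rule cuts_drop_cut)
  have "\<forall>l < Suc p. narrow M n (2 * (k + 1)) (Suc p) ?e l"
    using narrow_drop_cut[OF Suc.prems(1) a _ Suc.prems(2) narrow_pair_cuts[OF Suc.prems(1) i]]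
    by simp
  from Suc.IH[OF e this] obtain S where S: "S \<noteq> []" "hd S = cut_division (Suc p) ?e"
    "card (fst (last S)) = 1" "card (snd (last S)) = 1" "successively merge_step S"
    "\<forall>D\<in>set S. symmetric_division n D \<and> diagonal_division M (2 * (k + 1)) D"
    by blast
  then show ?case
    using merge_step_drop_cut[OF Suc.prems(1) a] symmetric_division_cut_division[OF Suc.prems(1)]
      diagonal_division_cut_division[OF M Suc.prems(1)] Suc.prems(2)
    by (intro exI[of _ "cut_division ?p c # S"]) (auto simp: successively_Cons)
qed

theorem theorem19:
  fixes n k :: nat and M :: "int mat"
  assumes "M \<in> carrier_mat n n" and "zero_one_mat M" and "symmetric_mat M"
    and "\<not> (\<exists>D. symmetric_division n D \<and> wide_division M k D)"
  shows "\<exists>S. symmetric_diagonal_division_sequence n M (2 * (k + 1)) S"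
proof -
  have id: "cuts n n id"
    by (simp add: cuts_def strict_mono_on_def)
  \<comment> \<open>The final partition must have exactly one part. For \<open>n = 0\<close> the
    division without parts is vacuously \<open>k\<close>-wide, contrary to the assumption.\<close>
  have "n \<noteq> 0"
  proof
    assume "n = 0"
    then have "wide_division M k (cut_division n id)"
      using wide_division_cut_division[OF assms(1,3) id] by simp
    then show False
      using assms(4) symmetric_division_cut_division[OF id] by blast
  qed
  then obtain p where p: "n = Suc p"
    using not0_implies_Suc by blast
  have singletons: "cut_division n id = (singletons n, singletons n)"
    by (simp add: cut_division_def set_blocks singletons_def atLeastLessThanSuc)
  \<comment> \<open>A singleton part has one distinct row, fewer than \<open>2 * (k + 1)\<close>, so
    any admissible window serves as witness.\<close>
  have "narrow M n (2 * (k + 1)) n id i" for i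
    unfolding narrow_def by (intro exI[of _ "int i"]) (simp add: distinct_rows_def atLeastLessThanSuc)
  then obtain S where "S \<noteq> []" "hd S = (singletons n, singletons n)"
    "card (fst (last S)) = 1" "card (snd (last S)) = 1" "successively merge_step S"
    "\<forall>D\<in>set S. symmetric_division n D \<and> diagonal_division M (2 * (k + 1)) D"
    using diagonal_sequence_from_cuts[OF assms(1,3,4), of p id] id singletons unfolding p by metis
  then show ?thesis
    by (auto simp: symmetric_diagonal_division_sequence_def symmetric_partition_sequence_def
        symmetric_division_def)
qed

end
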